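(* Let $X$ be a topological space and let $\mathcal{P}(X)$ be its power set ring. Then $X$ is compact (that is, quasi-compact and Hausdorff) if and only if every maximal ideal of $\mathcal{P}(X)$ converges to exactly one point of $X$.
   Context: For a set $X$, the power set ring $\mathcal{P}(X)$ is the commutative ring whose elements are the subsets of $X$, with addition the symmetric difference $A+B=(A\cup B)\setminus(A\cap B)$ and multiplication $A\cdot B=A\cap B$; its zero is $\emptyset$ and its unit is $X$. If $X$ is a topological space, $x\in X$ and $M$ is a maximal ideal of $\mathcal{P}(X)$, then $M$ is said to be convergent to (or to converge to) $x$ if for every open subset $U$ of $X$ containing $x$ one has $U\notin M$. Quasi-compact means that every open covering has a finite subcovering; compact means quasi-compact and Hausdorff. *)

theory Defs
  imports "HOL-Analysis.T1_Spaces" "HOL-Algebra.Ideal"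
begin

definition power_set_ring :: "'a set \<Rightarrow> 'a set ring"
  where "power_set_ring X =
    \<lparr>carrier = Pow X, mult = (\<inter>), one = X, zero = {}, add = (\<lambda>A B. (A \<union> B) - (A \<inter> B))\<rparr>"

lemma cring_power_set_ring: "cring (power_set_ring X)"
proof (rule cringI)
  show "abelian_group (power_set_ring X)"
  proof (rule abelian_groupI)
    fix A assume "A \<in> carrier (power_set_ring X)"
    then show "\<exists>B \<in> carrier (power_set_ring X).
        B \<oplus>\<^bsub>power_set_ring X\<^esub> A = \<zero>\<^bsub>power_set_ring X\<^esub>"
      by (intro bexI[of _ A]) (auto simp: power_set_ring_def)
  qed (auto simp: power_set_ring_def)
  show "comm_monoid (power_set_ring X)"
    by (rule comm_monoidI) (auto simp: power_set_ring_def)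
qed (auto simp: power_set_ring_def)

text \<open>
  The underlying set of the space is \<^term>\<open>topspace X\<close>, which may be a proper subset of the
  type; limits are required to be points of the space.
\<close>

definition converges_to :: "'a topology \<Rightarrow> 'a set set \<Rightarrow> 'a \<Rightarrow> bool"
  where "converges_to X M x \<longleftrightarrow>
    x \<in> topspace X \<and> (\<forall>U. openin X U \<and> x \<in> U \<longrightarrow> U \<notin> M)"

end

theory Submission
  imports Defs
begin

text \<open>
  Complementation turns the maximal ideals of the power set ring into the ultrafilters on the space,
  and convergence of a maximal ideal into convergence of the ultrafilter. The equivalence thus splits
  into two: every maximal ideal has \<^emph>\<open>at least\<close> one limit iff the space is quasi-compact, and
  \<^emph>\<open>at most\<close> one iff it is Hausdorff.

  A maximal ideal \<open>M\<close> is proper, closed under finite unions and prime. An ideal without a limit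
  contains an open neighbourhood of each point, hence an open cover, and no finite part of that cover
  can have the whole space as its union. If \<open>M\<close> had two limits with disjoint neighbourhoods
  \<open>U\<close> and \<open>V\<close>, then \<open>U \<inter> V = {} \<in> M\<close> would put one of them in \<open>M\<close>.

  For the two converses maximal ideals have to be constructed, and both times Zorn's lemma, in the
  form \<open>ex_maximalideal_superset\<close>, supplies them: a family of subsets of which no finite part
  covers the space lies in a maximal ideal. It is applied to an open cover without finite subcover,
  which gives a maximal ideal without limit, and to the complements of the open neighbourhoods of
  either of two inseparable points, which gives a maximal ideal converging to both.
\<close>

text \<open>
  In the power set ring the multiples of \<open>A\<close> are its subsets, and \<open>A \<union> B\<close> is the sum of \<open>A\<close>
  and the multiple \<open>B - A\<close> of \<open>B\<close>, while the sum of \<open>A\<close> and \<open>B\<close> is a subset of \<open>A \<union> B\<close>.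
  So the ideals are the order ideals of the Boolean lattice of subsets.
\<close>

lemma ideal_power_set_ring_iff:
  "ideal I (power_set_ring S) \<longleftrightarrow>
    I \<subseteq> Pow S \<and> {} \<in> I \<and> (\<forall>A\<in>I. \<forall>B\<in>I. A \<union> B \<in> I) \<and> (\<forall>A\<in>I. \<forall>B. B \<subseteq> A \<longrightarrow> B \<in> I)"
    (is "?ideal \<longleftrightarrow> ?order_ideal")
proof
  assume ?ideal
  then interpret ideal I "power_set_ring S" .
  have sub: "I \<subseteq> Pow S"
    using a_subset by (simp add: power_set_ring_def)
  have zero: "{} \<in> I"
    using additive_subgroup.zero_closed[OF is_additive_subgroup] by (simp add: power_set_ring_def)
  have down: "B \<in> I" if "A \<in> I" "B \<subseteq> A" for A B
  proof -
    have "B \<in> Pow S"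
      using that sub by blast
    then have "B \<inter> A \<in> I"
      using I_l_closed[OF that(1), of B] by (simp add: power_set_ring_def)
    then show ?thesis
      using that(2) by (simp add: Int_absorb2)
  qed
  have "A \<union> B \<in> I" if "A \<in> I" "B \<in> I" for A B
  proof -
    have "B - A \<in> I"
      using down[OF that(2)] by blast
    then have "(A \<union> (B - A)) - (A \<inter> (B - A)) \<in> I"
      using additive_subgroup.a_closed[OF is_additive_subgroup that(1), of "B - A"]
      by (simp add: power_set_ring_def)
    moreover have "(A \<union> (B - A)) - (A \<inter> (B - A)) = A \<union> B"
      by blast
    ultimately show ?thesis
      by simp
  qed
  with sub zero down show ?order_ideal
    by (intro conjI ballI allI impI)
next
  assume I: ?order_ideal
  then have down: "B \<in> I" if "A \<in> I" "B \<subseteq> A" for A B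
    using that by blast
  interpret R: cring "power_set_ring S"
    by (rule cring_power_set_ring)
  show ?ideal
  proof (rule idealI)
    show "ring (power_set_ring S)"
      by (rule R.ring_axioms)
    show "subgroup I (add_monoid (power_set_ring S))"
    proof (rule R.add.subgroupI)
      show "I \<subseteq> carrier (power_set_ring S)" "I \<noteq> {}"
        using I by (auto simp: power_set_ring_def)
    next
      fix A assume A: "A \<in> I"
      \<comment> \<open>The ring has characteristic 2.\<close>
      have "\<ominus>\<^bsub>power_set_ring S\<^esub> A = A"
        using A I by (intro R.minus_equality) (auto simp: power_set_ring_def)
      then show "\<ominus>\<^bsub>power_set_ring S\<^esub> A \<in> I"
        using A by simp
    next
      fix A B assume "A \<in> I" "B \<in> I"
      then have "A \<union> B \<in> I"
        using I by blast
      then have "(A \<union> B) - (A \<inter> B) \<in> I"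
        by (rule down) blast
      then show "A \<oplus>\<^bsub>power_set_ring S\<^esub> B \<in> I"
        by (simp add: power_set_ring_def)
    qed
  qed (auto simp: power_set_ring_def intro: down)
qed

lemma finite_Union_in_ideal:
  assumes "ideal I (power_set_ring S)" and "finite \<G>" "\<G> \<subseteq> I"
  shows "\<Union>\<G> \<in> I"
  using assms(2,3)
proof (induction rule: finite_induct)
  case empty
  then show ?case
    using assms(1) by (simp add: ideal_power_set_ring_iff)
next
  case (insert A \<G>)
  then have "A \<in> I" "\<Union>\<G> \<in> I"
    by auto
  then show ?case
    using assms(1) by (simp add: ideal_power_set_ring_iff)
qed

lemma carrier_notin_maximalideal:
  assumes "maximalideal M (power_set_ring S)"
  shows "S \<notin> M"
proof
  assume "S \<in> M"
  interpret maximalideal M "power_set_ring S"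
    by (rule assms)
  have "M = Pow S"
    using \<open>S \<in> M\<close> is_ideal unfolding ideal_power_set_ring_iff by blast
  then show False
    using I_notcarr by (simp add: power_set_ring_def)
qed

lemma maximalideal_power_set_ring_prime:
  assumes "maximalideal M (power_set_ring S)"
    and "A \<subseteq> S" "B \<subseteq> S" "A \<inter> B \<in> M"
  shows "A \<in> M \<or> B \<in> M"
proof -
  interpret cring "power_set_ring S"
    by (rule cring_power_set_ring)
  interpret primeideal M "power_set_ring S"
    by (rule maximalideal_prime[OF assms(1)])
  show ?thesis
    using I_prime[of A B] assms(2-4) by (simp add: power_set_ring_def)
qed

text \<open>
  The sets covered by finitely many members of \<open>\<F>\<close> form an ideal, the one generated by \<open>\<F>\<close>,
  and it is proper. Properness means not containing \<open>S\<close>, which passes to unions of chains, so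
  Zorn's lemma applies to the proper ideals containing \<open>\<F>\<close>.
\<close>

lemma ex_maximalideal_superset:
  assumes "\<F> \<subseteq> Pow S"
    and nocover: "\<And>\<G>. finite \<G> \<Longrightarrow> \<G> \<subseteq> \<F> \<Longrightarrow> \<not> S \<subseteq> \<Union>\<G>"
  obtains M where "maximalideal M (power_set_ring S)" "\<F> \<subseteq> M"
proof -
  define \<I> where "\<I> = {I. ideal I (power_set_ring S) \<and> \<F> \<subseteq> I \<and> S \<notin> I}"
  define I0 where "I0 = {A. A \<subseteq> S \<and> (\<exists>\<G>. finite \<G> \<and> \<G> \<subseteq> \<F> \<and> A \<subseteq> \<Union>\<G>)}"
  have "I0 \<in> \<I>"
  proof -
    have "A \<union> B \<in> I0" if "A \<in> I0" "B \<in> I0" for A B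
    proof -
      from that obtain \<G> \<H> where
        "finite \<G>" "\<G> \<subseteq> \<F>" "A \<subseteq> \<Union>\<G>" "finite \<H>" "\<H> \<subseteq> \<F>" "B \<subseteq> \<Union>\<H>"
        unfolding I0_def by blast
      then have "finite (\<G> \<union> \<H>) \<and> \<G> \<union> \<H> \<subseteq> \<F> \<and> A \<union> B \<subseteq> \<Union>(\<G> \<union> \<H>)"
        by blast
      then show ?thesis
        using that unfolding I0_def by blast
    qed
    moreover have "{} \<in> I0"
      unfolding I0_def by blast
    moreover have "B \<in> I0" if "A \<in> I0" "B \<subseteq> A" for A B
      using that unfolding I0_def by blast
    moreover have "I0 \<subseteq> Pow S"
      unfolding I0_def by blast
    ultimately have "ideal I0 (power_set_ring S)"
      unfolding ideal_power_set_ring_iff by blast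
    moreover have "A \<in> I0" if "A \<in> \<F>" for A
    proof -
      have "finite {A} \<and> {A} \<subseteq> \<F> \<and> A \<subseteq> \<Union>{A}"
        using that by simp
      then show ?thesis
        using that assms(1) unfolding I0_def by blast
    qed
    moreover have "S \<notin> I0"
      using nocover unfolding I0_def by blast
    ultimately show ?thesis
      unfolding \<I>_def by blast
  qed
  have chain: "\<Union>\<C> \<in> \<I>" if "\<C> \<noteq> {}" "subset.chain \<I> \<C>" for \<C>
  proof -
    have \<C>: "I \<in> \<I>" if "I \<in> \<C>" for I
      using that \<open>subset.chain \<I> \<C>\<close> by (auto simp: subset_chain_def)
    then have ideal: "I \<subseteq> Pow S \<and> {} \<in> I \<and> (\<forall>A\<in>I. \<forall>B\<in>I. A \<union> B \<in> I)
        \<and> (\<forall>A\<in>I. \<forall>B. B \<subseteq> A \<longrightarrow> B \<in> I)" if "I \<in> \<C>" for I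
      using that unfolding \<I>_def ideal_power_set_ring_iff[symmetric] by blast
    have "A \<union> B \<in> \<Union>\<C>" if "A \<in> I" "I \<in> \<C>" "B \<in> J" "J \<in> \<C>" for A B I J
    proof -
      have "I \<subseteq> J \<or> J \<subseteq> I"
        using that \<open>subset.chain \<I> \<C>\<close> by (auto simp: subset_chain_def)
      then show ?thesis
        using that ideal by (meson UnionI subsetD)
    qed
    then have "\<forall>A\<in>\<Union>\<C>. \<forall>B\<in>\<Union>\<C>. A \<union> B \<in> \<Union>\<C>"
      by blast
    moreover have "\<Union>\<C> \<subseteq> Pow S" "\<forall>A\<in>\<Union>\<C>. \<forall>B. B \<subseteq> A \<longrightarrow> B \<in> \<Union>\<C>"
      using ideal by blast+
    moreover have "{} \<in> \<Union>\<C>"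
      using ideal \<open>\<C> \<noteq> {}\<close> by blast
    ultimately have "ideal (\<Union>\<C>) (power_set_ring S)"
      unfolding ideal_power_set_ring_iff by blast
    moreover have "\<F> \<subseteq> \<Union>\<C>" "S \<notin> \<Union>\<C>"
      using \<C> \<open>\<C> \<noteq> {}\<close> unfolding \<I>_def by blast+
    ultimately show ?thesis
      unfolding \<I>_def by blast
  qed
  obtain M where "M \<in> \<I>" and max: "\<And>J. J \<in> \<I> \<Longrightarrow> M \<subseteq> J \<Longrightarrow> J = M"
    using subset_Zorn_nonempty[of \<I>] \<open>I0 \<in> \<I>\<close> chain by blast
  then have M: "ideal M (power_set_ring S)" "\<F> \<subseteq> M" "S \<notin> M"
    unfolding \<I>_def by auto
  have "maximalideal M (power_set_ring S)"
  proof (rule maximalidealI[OF M(1)])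
    show "carrier (power_set_ring S) \<noteq> M"
      using M(3) by (auto simp: power_set_ring_def)
    fix J assume J: "ideal J (power_set_ring S)" "M \<subseteq> J"
    show "J = M \<or> J = carrier (power_set_ring S)"
    proof (cases "S \<in> J")
      case True
      then have "J = Pow S"
        using J(1) unfolding ideal_power_set_ring_iff by blast
      then show ?thesis
        by (simp add: power_set_ring_def)
    next
      case False
      then have "J \<in> \<I>"
        using J M(2) unfolding \<I>_def by blast
      then show ?thesis
        using max J(2) by blast
    qed
  qed
  then show ?thesis
    using that M(2) by blast
qed

lemma compact_space_iff_maximalideals_converge:
  "compact_space X \<longleftrightarrow>
    (\<forall>M. maximalideal M (power_set_ring (topspace X)) \<longrightarrow> (\<exists>x. converges_to X M x))"
    (is "_ \<longleftrightarrow> ?conv")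
proof
  assume compact: "compact_space X"
  show ?conv
  proof (intro allI impI, rule ccontr)
    fix M assume M: "maximalideal M (power_set_ring (topspace X))"
      and "\<nexists>x. converges_to X M x"
    then have "\<exists>U. openin X U \<and> x \<in> U \<and> U \<in> M" if "x \<in> topspace X" for x
      using that unfolding converges_to_def by blast
    then have "topspace X \<subseteq> \<Union>{U \<in> M. openin X U}"
      by blast
    then obtain \<G> where \<G>: "finite \<G>" "\<G> \<subseteq> {U \<in> M. openin X U}" "topspace X \<subseteq> \<Union>\<G>"
      using compact unfolding compact_space_alt by (metis (mono_tags, lifting) mem_Collect_eq)
    have "\<Union>\<G> \<in> M"
      using finite_Union_in_ideal[OF maximalideal.axioms(1)[OF M]] \<G>(1,2) by blast
    moreover have "\<Union>\<G> = topspace X"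
      using \<G>(2,3) openin_subset by blast
    ultimately show False
      using carrier_notin_maximalideal[OF M] by simp
  qed
next
  assume conv: ?conv
  show "compact_space X"
    unfolding compact_space_alt
  proof (intro allI impI, elim conjE, rule ccontr)
    fix \<U> assume \<U>: "\<forall>U\<in>\<U>. openin X U" "topspace X \<subseteq> \<Union>\<U>"
      and "\<nexists>\<G>. finite \<G> \<and> \<G> \<subseteq> \<U> \<and> topspace X \<subseteq> \<Union>\<G>"
    then have nocover: "\<not> topspace X \<subseteq> \<Union>\<G>" if "finite \<G>" "\<G> \<subseteq> \<U>" for \<G>
      using that by blast
    have "\<U> \<subseteq> Pow (topspace X)"
      using \<U>(1) openin_subset by blast
    then obtain M where M: "maximalideal M (power_set_ring (topspace X))" "\<U> \<subseteq> M"
      using nocover by (rule ex_maximalideal_superset)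
    then obtain x where "converges_to X M x"
      using conv by blast
    then show False
      using \<U> M(2) unfolding converges_to_def by blast
  qed
qed

text \<open>
  An ideal that contains the complements of all open neighbourhoods of a point and is proper contains
  none of the neighbourhoods themselves, so it converges to that point. When two points have no
  disjoint neighbourhoods, the complements for both points together have no finite part covering the
  space, since that would make a neighbourhood of one point disjoint from a neighbourhood of the other.
\<close>

lemma Hausdorff_space_iff_maximalideal_limits_unique:
  "Hausdorff_space X \<longleftrightarrow>
    (\<forall>M x y. maximalideal M (power_set_ring (topspace X)) \<and> converges_to X M x \<and> converges_to X M y
      \<longrightarrow> x = y)"
    (is "_ \<longleftrightarrow> ?unique")
proof
  assume Hausdorff: "Hausdorff_space X"
  show ?unique
  proof (intro allI impI, elim conjE, rule ccontr)
    fix M x y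
    assume M: "maximalideal M (power_set_ring (topspace X))"
      and conv: "converges_to X M x" "converges_to X M y" and "x \<noteq> y"
    then obtain U V where UV: "openin X U" "openin X V" "x \<in> U" "y \<in> V" "disjnt U V"
      using Hausdorff unfolding Hausdorff_space_def converges_to_def by metis
    have "U \<inter> V \<in> M"
      using UV(5) maximalideal.axioms(1)[OF M] by (simp add: disjnt_def ideal_power_set_ring_iff)
    then have "U \<in> M \<or> V \<in> M"
      using maximalideal_power_set_ring_prime[OF M] UV(1,2) openin_subset by blast
    then show False
      using conv UV unfolding converges_to_def by blast
  qed
next
  assume unique: ?unique
  show "Hausdorff_space X"
    unfolding Hausdorff_space_def
  proof (intro allI impI, elim conjE, rule ccontr)
    fix x y
    assume x: "x \<in> topspace X" and y: "y \<in> topspace X" and "x \<noteq> y"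
      and "\<nexists>U V. openin X U \<and> openin X V \<and> x \<in> U \<and> y \<in> V \<and> disjnt U V"
    then have meet: "U \<inter> V \<noteq> {}" if "openin X U" "openin X V" "x \<in> U" "y \<in> V" for U V
      using that unfolding disjnt_def by blast
    define N where "N z = {topspace X - U |U. openin X U \<and> z \<in> U}" for z
    have closed: "closedin X A \<and> z \<notin> A" if "A \<in> N z" for A z
      using that unfolding N_def by auto
    obtain M where M: "maximalideal M (power_set_ring (topspace X))" "N x \<union> N y \<subseteq> M"
    proof (rule ex_maximalideal_superset[of "N x \<union> N y" "topspace X"])
      show "N x \<union> N y \<subseteq> Pow (topspace X)"
        unfolding N_def by blast
      fix \<G> assume \<G>: "finite \<G>" "\<G> \<subseteq> N x \<union> N y"
      define A where "A z = \<Union>(\<G> \<inter> N z)" for z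
      \<comment> \<open>The closed sets avoiding \<open>z\<close> are closed under finite unions, so \<open>\<G>\<close> may be replaced by one
        closed set for each of the two points.\<close>
      have "closedin X (A z)" "z \<notin> A z" for z
        unfolding A_def using \<G>(1) closed by (auto intro: closedin_Union)
      then have "(topspace X - A x) \<inter> (topspace X - A y) \<noteq> {}"
        using meet x y by (simp add: closedin_def)
      moreover have "\<Union>\<G> = A x \<union> A y"
        using \<G>(2) unfolding A_def by blast
      ultimately show "\<not> topspace X \<subseteq> \<Union>\<G>"
        by blast
    qed blast
    have conv: "converges_to X M z" if "z \<in> topspace X" "N z \<subseteq> M" for z
    proof -
      have False if "openin X U" "z \<in> U" "U \<in> M" for U
      proof -
        have "topspace X - U \<in> M"
          using that \<open>N z \<subseteq> M\<close> unfolding N_def by blast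
        then have "U \<union> (topspace X - U) \<in> M"
          using \<open>U \<in> M\<close> maximalideal.axioms(1)[OF M(1)] unfolding ideal_power_set_ring_iff by blast
        moreover have "U \<union> (topspace X - U) = topspace X"
          using openin_subset[OF \<open>openin X U\<close>] by blast
        ultimately show False
          using carrier_notin_maximalideal[OF M(1)] by simp
      qed
      then show ?thesis
        using \<open>z \<in> topspace X\<close> unfolding converges_to_def by blast
    qed
    then have "x = y"
      using unique M x y by blast
    then show False
      using \<open>x \<noteq> y\<close> by simp
  qed
qed

theorem corollary3p5:
  fixes X :: "'a topology"
  shows "compact_space X \<and> Hausdorff_space X \<longleftrightarrow>
    (\<forall>M. maximalideal M (power_set_ring (topspace X)) \<longrightarrow> (\<exists>!x. converges_to X M x))"
  unfolding compact_space_iff_maximalideals_converge Hausdorff_space_iff_maximalideal_limits_unique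
  by blast

end
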